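(* Let $n\ge1$. The $0,1$-valued elements of $\mathrm{dWMET}_n$ are exactly the $\sum_{t=1}^n2^tS(n,t)$ pairs $(\delta(\mathcal S);w)$ where $\mathcal S=\{S_1,\dots,S_t\}$ is a partition of $V_n$ into $t$ nonempty parts and $w\in\{0,1\}^n$ is constant on each part $S_h$. The extreme rays of $0,1\text{-}\mathrm{dWMET}_n$ are exactly the rays spanned by $(0;(1,\dots,1))$ and, for each $2$-cut $\delta(S)$ ($\emptyset\ne S\subsetneq V_n$), by $(\delta(S);0)$, $(\delta(S);w')$ and $(\delta(S);w'')$, where $w'_i=1$ iff $i\in S$ and $w''_i=1$ iff $i\notin S$. There are $1+3(2^{n-1}-1)$ of them, forming $\lfloor\frac{3n}{2}\rfloor$ orbits under the action of $\mathrm{Sym}(n)$ permuting $V_n$.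
   Context: $V_n=\{1,\dots,n\}$. $\mathrm{dWMET}_n$ is the cone of pairs $(d;w)$ with $d$ a semimetric on $V_n$ (symmetric, $d_{ii}=0$, $d_{ik}+d_{kj}\ge d_{ij}$), $w\in\mathbb{R}^n_{\ge0}$, and $d_{ij}\ge w_i-w_j$ for all distinct $i,j$. An element is $0,1$-valued if all $d_{ij}$ and $w_i$ lie in $\{0,1\}$. For a partition $\mathcal S$ of $V_n$, the multicut $\delta(\mathcal S)$ has $\delta_{ij}=1$ if $i,j$ lie in different parts and $0$ otherwise; $\delta(S)=\delta(\{S,V_n\setminus S\})$. $S(n,t)$ is the Stirling number of the second kind. For a cone $C$, $0,1\text{-}C$ is the cone generated by all extreme rays of $C$ containing a nonzero $0,1$-valued point. *)

theory Defs
  imports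
    "HOL-Analysis.Analysis"
    "HOL-Algebra.Group_Action"
    "HOL-Combinatorics.Stirling"
    "HOL-Library.Disjoint_Sets"
begin

text \<open>The finite type \<open>'n\<close> plays the role of \<open>V\<^sub>n\<close>, with \<open>n = CARD('n)\<close>.
  The function \<open>d\<close> is kept as a full matrix, symmetric with zero diagonal.\<close>

type_synonym 'n weighted_dist = "(real^'n^'n) \<times> (real^'n)"

text \<open>Nonnegativity of \<open>d\<close> is the instance \<open>i = j\<close> of the triangle inequality.\<close>

definition semimetric :: "real^'n^'n \<Rightarrow> bool" where
  "semimetric d \<longleftrightarrow>
     (\<forall>i j. d $ i $ j = d $ j $ i) \<and>
     (\<forall>i. d $ i $ i = 0) \<and>
     (\<forall>i j k. d $ i $ k + d $ k $ j \<ge> d $ i $ j)"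

definition dWMET :: "('n::finite) weighted_dist set" where
  "dWMET = {(d, w). semimetric d \<and> (\<forall>i. w $ i \<ge> 0) \<and>
                    (\<forall>i j. i \<noteq> j \<longrightarrow> d $ i $ j \<ge> w $ i - w $ j)}"

definition zero_one_valued :: "('n::finite) weighted_dist \<Rightarrow> bool" where
  "zero_one_valued = (\<lambda>(d, w). (\<forall>i j. d $ i $ j \<in> {0, 1}) \<and> (\<forall>i. w $ i \<in> {0, 1}))"

definition multicut :: "'n set set \<Rightarrow> real^'n^'n" where
  "multicut P = (\<chi> i j. if \<exists>A\<in>P. i \<in> A \<and> j \<in> A then 0 else 1)"

definition cut_dist :: "'n set \<Rightarrow> real^'n^'n" where
  "cut_dist S = multicut {S, - S}"

definition indicator_vec :: "'n set \<Rightarrow> real^'n" where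
  "indicator_vec S = (\<chi> i. if i \<in> S then 1 else 0)"

text \<open>For \<open>v \<noteq> 0\<close>, \<open>cone hull {v}\<close> is the closed half-line \<open>{c *\<^sub>R v | c. c \<ge> 0}\<close>
  spanned by \<open>v\<close>.\<close>

definition extreme_rays :: "'a::real_vector set \<Rightarrow> 'a set set" where
  "extreme_rays C = {R. R face_of C \<and> (\<exists>v. v \<noteq> 0 \<and> R = cone hull {v})}"

definition zero_one_cone :: "('n::finite) weighted_dist set \<Rightarrow> 'n weighted_dist set" where
  "zero_one_cone C =
     convex_cone hull \<Union>{R \<in> extreme_rays C. \<exists>x\<in>R. x \<noteq> 0 \<and> zero_one_valued x}"

abbreviation zero_one_dWMET :: "('n::finite) weighted_dist set" where
  "zero_one_dWMET \<equiv> zero_one_cone dWMET"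

text \<open>The left action of permutations: \<open>(p \<cdot> d) (p i) (p j) = d i j\<close> and
  \<open>(p \<cdot> w) (p i) = w i\<close>.\<close>

definition relabel :: "('n \<Rightarrow> 'n) \<Rightarrow> ('n::finite) weighted_dist \<Rightarrow> 'n weighted_dist" where
  "relabel p = (\<lambda>(d, w). (\<chi> i j. d $ inv_into UNIV p i $ inv_into UNIV p j,
                           \<chi> i. w $ inv_into UNIV p i))"

end

theory Submission imports Defs begin

text \<open>Let \<open>x = (d; w)\<close> be a nonzero zero-one point. If two classes at distance 1 carry the same
  weight, then the distance between them can be changed by \<open>\<plusminus>1/2\<close> inside \<open>dWMET\<close>; so if \<open>x\<close> spans an
  extreme ray, the perturbation is proportional to \<open>x\<close> and \<open>x = (\<delta>(S); 0)\<close>. Otherwise classes are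
  told apart by their weights, so there are at most two of them and \<open>x = (\<delta>(S); 1\<^sub>S)\<close>. Conversely
  the inequalities tight at such a point determine it up to scaling. A cone generated by extreme rays
  of a larger cone has no further extreme rays, since removing a ray that is a face leaves a
  convex cone.\<close>

subsection \<open>Extreme rays of convex cones\<close>

text \<open>The amount 1/2 comes from the triangle inequality: values in an interval [m, 2 m]
  satisfy it automatically, and raising some unit distances to 3/2 keeps all nonzero distances in
  [1, 2], while lowering them to 1/2 keeps them in [1/2, 1]. Equal weights are the obstacle to avoid
  losing: a unit distance between points of weights 1 and 0 makes the weight inequality tight, so it
  cannot shrink, whereas between equal weights there is slack. Proportionality is strong because the
  perturbation leaves the weights alone and touches a single pair of classes: the weights must
  vanish, and every unit distance must join these two classes. For the count of zero-one points, a
  weight constant on blocks is a choice of blocks, so a partition into t parts carries 2^t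
  weights.\<close>

lemma mem_ray_iff: "x \<in> cone hull {v :: 'a::real_vector} \<longleftrightarrow> (\<exists>c\<ge>0. x = c *\<^sub>R v)"
  by (auto simp: cone_hull_expl)

lemma ray_eq_if_mem:
  fixes v x :: "'a::real_vector"
  assumes "x \<in> cone hull {v}" "x \<noteq> 0"
  shows "cone hull {x} = cone hull {v}"
proof -
  obtain c where c: "c > 0" "x = c *\<^sub>R v"
    using assms by (force simp: mem_ray_iff less_eq_real_def)
  have v: "v = (1 / c) *\<^sub>R x" using c by simp
  have "y \<in> cone hull {v}" if "y \<in> cone hull {x}" for y
    using that c unfolding mem_ray_iff by (metis less_imp_le mult_nonneg_nonneg scaleR_scaleR)
  moreover have "y \<in> cone hull {x}" if "y \<in> cone hull {v}" for y
    using that v c(1) unfolding mem_ray_iff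
    by (metis less_imp_le mult_nonneg_nonneg scaleR_scaleR zero_le_divide_1_iff)
  ultimately show ?thesis by blast
qed

lemma extreme_rays_iff_mem:
  assumes "R \<in> extreme_rays C" "x \<in> R" "x \<noteq> 0"
  shows "R = cone hull {x}"
  using assms ray_eq_if_mem unfolding extreme_rays_def by blast

text \<open>Nonnegative functionals vanishing at a point vanish on the endpoints of every segment of
  \<open>C\<close> through it, so it suffices that the constraints tight at \<open>v\<close> cut out the ray.\<close>

lemma extreme_raysI:
  fixes v :: "'a::real_vector"
  assumes "convex_cone C" "v \<in> C" "v \<noteq> 0"
    and tight: "\<And>x. x \<in> C \<Longrightarrow>
      (\<And>f :: 'a \<Rightarrow> real. linear f \<Longrightarrow> (\<forall>y\<in>C. 0 \<le> f y) \<Longrightarrow> f v = 0 \<Longrightarrow> f x = 0) \<Longrightarrow> x \<in> cone hull {v}"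
  shows "cone hull {v} \<in> extreme_rays C"
proof -
  have "a \<in> cone hull {v} \<and> b \<in> cone hull {v}"
    if ab: "a \<in> C" "b \<in> C" and x: "x \<in> cone hull {v}" and seg: "x \<in> open_segment a b" for a b x
  proof -
    obtain u where u: "0 < u" "u < 1" "x = (1 - u) *\<^sub>R a + u *\<^sub>R b"
      using seg by (auto simp: in_segment)
    have "f a = 0 \<and> f b = 0" if f: "linear f" "\<forall>y\<in>C. 0 \<le> f y" "f v = 0" for f :: "'a \<Rightarrow> real"
    proof -
      have "f x = 0"
        using x f by (auto simp: mem_ray_iff linear_scale)
      then have "(1 - u) * f a + u * f b = 0"
        using u f by (simp add: linear_add linear_scale)
      moreover have "(1 - u) * f a \<ge> 0" "u * f b \<ge> 0"
        using u f ab by simp_all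
      ultimately have "(1 - u) * f a = 0" "u * f b = 0" by linarith+
      then show ?thesis using u by simp
    qed
    then show ?thesis using tight ab by blast
  qed
  moreover have "cone hull {v} \<subseteq> C"
    using assms by (auto simp: mem_ray_iff convex_cone_scaleR)
  moreover have "convex (cone hull {v})"
    by (simp add: convex_cone_hull)
  ultimately show ?thesis
    using assms unfolding extreme_rays_def face_of_def by blast
qed

text \<open>The point \<open>x\<close> is the midpoint of \<open>x + e\<close> and
  \<open>x - e\<close>, so the face \<open>R\<close> contains both endpoints, and \<open>R\<close>
  is the ray of \<open>x\<close>. This is the test by which zero-one points off the list are
  excluded.\<close>

lemma extreme_rays_perturb:
  assumes R: "R \<in> extreme_rays C" and x: "x \<in> R" "x \<noteq> 0"
    and "x + e \<in> C" "x - e \<in> C"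
  shows "\<exists>c. e = c *\<^sub>R x"
proof (cases "e = 0")
  case False
  have "x + e \<noteq> x - e"
  proof
    assume "x + e = x - e"
    then have "2 *\<^sub>R e = 0" by (simp add: scaleR_2 eq_neg_iff_add_eq_0)
    then show False using False by simp
  qed
  moreover have "x = (1 - 1 / 2) *\<^sub>R (x + e) + (1 / 2) *\<^sub>R (x - e)"
    by (simp add: scaleR_add_right scaleR_diff_right flip: scaleR_add_left)
  ultimately have "x \<in> open_segment (x + e) (x - e)"
    unfolding in_segment by (intro conjI exI[of _ "1 / 2"]) simp_all
  then have "x + e \<in> R"
    using assms unfolding extreme_rays_def face_of_def by blast
  then obtain c where "x + e = c *\<^sub>R x"
    using extreme_rays_iff_mem[OF R x] by (auto simp: mem_ray_iff)
  then have "e = (c - 1) *\<^sub>R x" by (simp add: algebra_simps)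
  then show ?thesis ..
qed (simp add: exI[of _ 0])

text \<open>A face of \<open>C\<close> lying in a subcone is a face of the subcone, which gives one
  inclusion. Conversely, if an extreme ray \<open>R\<close> of the hull met the generators only in
  0, the hull without the nonzero points of \<open>R\<close> would be a convex cone containing all
  generators, hence the whole hull. So \<open>R\<close> shares a nonzero point with a generating ray
  and equals it.\<close>

lemma extreme_rays_convex_cone_hull:
  fixes C :: "'a::real_vector set"
  assumes C: "convex_cone C" and Rs: "Rs \<subseteq> extreme_rays C"
  shows "extreme_rays (convex_cone hull \<Union>Rs) = Rs"
proof
  let ?K = "convex_cone hull \<Union>Rs"
  have "\<Union>Rs \<subseteq> C"
    using Rs by (auto simp: extreme_rays_def dest: face_of_imp_subset)
  then have KC: "?K \<subseteq> C"
    using C by (simp add: hull_minimal)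
  show "Rs \<subseteq> extreme_rays ?K"
  proof
    fix R assume R: "R \<in> Rs"
    then have "R \<subseteq> ?K"
      by (auto intro: hull_inc)
    then show "R \<in> extreme_rays ?K"
      using subsetD[OF Rs R] face_of_subset[OF _ _ KC] by (simp add: extreme_rays_def)
  qed
  show "extreme_rays ?K \<subseteq> Rs"
  proof
    fix R assume R: "R \<in> extreme_rays ?K"
    then obtain v where v: "v \<noteq> 0" "R = cone hull {v}" and face: "R face_of ?K"
      by (auto simp: extreme_rays_def)
    have "v \<in> R" using v by (simp add: hull_inc)
    have Rcone: "c *\<^sub>R x \<in> R" if "x \<in> R" "c > 0" for c x
      using that cone_cone_hull[of "{v}"] v by (simp add: mem_cone)
    \<comment> \<open>Read contrapositively, positive scaling also keeps points outside
      \<open>R\<close>, which makes \<open>?Q\<close> closed under scaling.\<close>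
    have Rscale: "c *\<^sub>R x \<in> R \<longleftrightarrow> x \<in> R" if "c > 0" for c x
      using Rcone[of x c] Rcone[of "c *\<^sub>R x" "1 / c"] that by auto
    have "\<exists>x. x \<in> \<Union>Rs \<inter> R \<and> x \<noteq> 0"
    proof (rule ccontr)
      assume no: "\<nexists>x. x \<in> \<Union>Rs \<inter> R \<and> x \<noteq> 0"
      \<comment> \<open>Since \<open>R\<close> is a face, removing it from the cone leaves a cone.\<close>
      let ?Q = "insert 0 (?K - R)"
      have add: "x + y \<notin> R" if "x \<in> ?K - R" "y \<in> ?K - R" for x y
      proof
        assume "x + y \<in> R"
        \<comment> \<open>The face condition speaks of open segments, so the sum is halved to a
          midpoint. For \<open>x = y\<close> the open segment is empty, but then the midpoint is
          \<open>x\<close> itself.\<close>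
        then have mid: "(1/2) *\<^sub>R (x + y) \<in> R" by (simp add: Rscale)
        show False
        proof (cases "x = y")
          case True
          then have "(1/2) *\<^sub>R (x + y) = x" by (simp flip: scaleR_2)
          then show False using mid that by simp
        next
          case False
          moreover have "(1/2) *\<^sub>R (x + y) = (1 - 1/2) *\<^sub>R x + (1/2) *\<^sub>R y"
            by (simp add: scaleR_add_right)
          ultimately have "(1/2) *\<^sub>R (x + y) \<in> open_segment x y"
            unfolding in_segment by (intro conjI exI[of _ "1/2"]) simp_all
          then show False using face mid that unfolding face_of_def by blast
        qed
      qed
      have K: "convex_cone ?K" by (rule convex_cone_convex_cone_hull)
      have "convex_cone ?Q"
      proof (intro convex_cone_iff[THEN iffD2] conjI ballI allI impI)
        fix x y assume "x \<in> ?Q" "y \<in> ?Q"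
        then show "x + y \<in> ?Q" using add convex_cone_add[OF K] by auto
      next
        fix x and c :: real assume "x \<in> ?Q" "0 \<le> c"
        then show "c *\<^sub>R x \<in> ?Q"
          using Rscale convex_cone_scaleR[OF K] by (cases "c = 0") auto
      qed auto
      moreover have "\<Union>Rs \<subseteq> ?Q"
        using no hull_subset[of "\<Union>Rs" convex_cone] by blast
      ultimately have "?K \<subseteq> ?Q" by (simp add: hull_minimal)
      then show False using \<open>v \<in> R\<close> v face face_of_imp_subset by blast
    qed
    then obtain x R' where x: "x \<in> R" "x \<noteq> 0" "x \<in> R'" "R' \<in> Rs" by blast
    have "R = cone hull {x}" by (rule extreme_rays_iff_mem[OF R x(1,2)])
    also have "\<dots> = R'" using extreme_rays_iff_mem[of R' C x] x Rs by blast
    finally show "R \<in> Rs" using x by simp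
  qed
qed

subsection \<open>Counting partitions\<close>

text \<open>Deleting \<open>a\<close> from its block either empties the block or leaves a block
  \<open>B\<close> of a partition of \<open>A\<close>. These are the two terms of the Stirling
  recursion; the second kind is indexed by pairs \<open>(P, B)\<close> so that the choice of
  \<open>B\<close> can be counted.\<close>

lemma partitions_insert:
  assumes a: "a \<notin> A"
  shows "{P. partition_on (insert a A) P} =
    insert {a} ` {P. partition_on A P} \<union>
    (\<lambda>(P, B). insert (insert a B) (P - {B})) ` (SIGMA P:{P. partition_on A P}. P)" (is "?L = ?R1 \<union> ?R2")
proof (intro Set.set_eqI iffI)
  fix Q assume "Q \<in> ?L"
  then have Q: "\<Union>Q = insert a A" "disjoint Q" "{} \<notin> Q" by (auto simp: partition_on_def)
  then obtain C where C: "C \<in> Q" "a \<in> C" by (metis UnionE insertI1)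
  have disj: "C \<inter> D = {}" if "D \<in> Q" "D \<noteq> C" for D
    using that C(1) Q(2) by (metis disjnt_def pairwiseD)
  have rest: "\<Union>(Q - {C}) = insert a A - C"
    unfolding Q(1)[symmetric] using disj by fast
  show "Q \<in> ?R1 \<union> ?R2"
  proof (cases "C = {a}")
    case True
    then have "partition_on A (Q - {C})"
      using Q rest a by (auto simp: partition_on_def pairwise_def)
    moreover have "Q = insert {a} (Q - {C})" using C True by blast
    ultimately show ?thesis by blast
  next
    case False
    let ?B = "C - {a}"
    have B: "?B \<noteq> {}" using False C by blast
    have CA: "C \<subseteq> insert a A" using C Q by blast
    \<comment> \<open>Needed so that inserting \<open>?B\<close> and removing it again returns
      \<open>Q - {C}\<close>.\<close>
    have B_notin: "?B \<notin> Q - {C}" using disj B by blast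
    have "disjnt ?B (\<Union>(Q - {C}))" using rest by (auto simp: disjnt_iff)
    moreover have "partition_on (A - ?B) (Q - {C})"
      using Q rest a C CA by (auto simp: partition_on_def pairwise_def)
    ultimately have "partition_on A (insert ?B (Q - {C}))"
      using B CA by (auto simp: partition_on_insert)
    moreover have "Q = insert (insert a ?B) (insert ?B (Q - {C}) - {?B})"
      using C B_notin by (auto simp: insert_absorb)
    ultimately show ?thesis by (intro UnI2) (rule image_eqI[of _ _ "(insert ?B (Q - {C}), ?B)"]; simp)
  qed
next
  fix Q assume "Q \<in> ?R1 \<union> ?R2"
  then show "Q \<in> ?L"
  proof
    assume "Q \<in> ?R1"
    then obtain P where P: "partition_on A P" "Q = insert {a} P" by blast
    moreover have "disjnt {a} (\<Union>P)" using P a by (auto simp: partition_on_def)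
    ultimately show ?thesis using a by (simp add: partition_on_insert)
  next
    assume "Q \<in> ?R2"
    then obtain P B where P: "partition_on A P" "B \<in> P" and Q: "Q = insert (insert a B) (P - {B})"
      by auto
    have "disjnt B (\<Union>(P - {B}))"
      using P by (fastforce simp: partition_on_def pairwise_def disjnt_iff)
    then have "partition_on (A - B) (P - {B})" "B \<subseteq> A" "disjnt (insert a B) (\<Union>(P - {B}))"
      using P a partition_on_insert[of B "P - {B}" A]
      by (auto simp: insert_absorb partition_on_def disjnt_iff)
    then show ?thesis using a by (auto simp: Q partition_on_insert)
  qed
qed

text \<open>The enlarged block is the only one containing \<open>a\<close>, so it can be located in
  the result; removing \<open>a\<close> from it recovers \<open>B\<close>, and then
  \<open>P\<close>.\<close>

lemma inj_on_partition_insert_block: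
  assumes a: "a \<notin> A"
  shows "inj_on (\<lambda>(P, B). insert (insert a B) (P - {B})) (SIGMA P:{P. partition_on A P}. P)"
proof (rule inj_onI; clarify)
  fix P B P' B'
  assume P: "partition_on A P" "B \<in> P" and P': "partition_on A P'" "B' \<in> P'"
    and eq: "insert (insert a B) (P - {B}) = insert (insert a B') (P' - {B'})"
  have no: "a \<notin> D" if "D \<in> P \<or> D \<in> P'" for D
    using that P P' a by (auto simp: partition_on_def)
  have "insert a B \<in> insert (insert a B') (P' - {B'})"
    using eq by auto
  then have "insert a B = insert a B'"
    using no by auto
  moreover have "a \<notin> B" "a \<notin> B'" using no P P' by auto
  ultimately have B: "B = B'" by (simp add: insert_ident)
  have "insert a B \<notin> P - {B}" "insert a B \<notin> P' - {B}" using no by auto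
  then have "P - {B} = P' - {B}" using eq B by (simp add: insert_ident)
  then show "P = P' \<and> B = B'" using B P P' insert_Diff by metis
qed

lemma card_partitions_eq_Stirling:
  assumes "finite A"
  shows "card {P. partition_on A P \<and> card P = t} = Stirling (card A) t"
  using assms
proof (induction A arbitrary: t rule: finite_induct)
  case empty
  have "{P :: 'a set set. partition_on {} P \<and> card P = t} = (if t = 0 then {{}} else {})"
    by (auto simp: partition_on_empty)
  then have "card {P :: 'a set set. partition_on {} P \<and> card P = t} = card (if t = 0 then {{} :: 'a set set} else {})"
    by (rule arg_cong)
  then show ?case by (cases t) simp_all
next
  case (insert a A)
  have fin: "finite P" if "partition_on A P" for P
    using that insert finite_elements by blast
  have notin: "{a} \<notin> P" "insert a B \<notin> P" if "partition_on A P" for P B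
    using that insert by (auto simp: partition_on_def)
  have card1: "card (insert {a} P) = Suc (card P)" if "partition_on A P" for P
    using that fin notin by simp
  have card2: "card (insert (insert a B) (P - {B})) = card P" if "partition_on A P" "B \<in> P" for P B
    using card_Suc_Diff1[OF fin[OF that(1)] that(2)] fin[OF that(1)] notin[OF that(1)] by simp
  show ?case
  proof (cases t)
    case 0
    have "card P \<noteq> 0" if "partition_on (insert a A) P" for P
      using that insert(1) finite_elements[of "insert a A" P] by (auto simp: partition_on_def)
    then have "{P. partition_on (insert a A) P \<and> card P = t} = {}"
      using 0 by blast
    then have "card {P. partition_on (insert a A) P \<and> card P = t} = card ({} :: 'a set set set)"
      by (rule arg_cong)
    then show ?thesis using 0 insert by simp
  next
    case (Suc k)
    let ?S = "SIGMA P:{P. partition_on A P \<and> card P = t}. P"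
    \<comment> \<open>Moves the condition on the number of blocks from an image to its index set,
      where \<open>card1\<close> and \<open>card2\<close> evaluate it.\<close>
    have filter_image: "{Q \<in> g ` U. card Q = t} = g ` {u \<in> U. card (g u) = t}"
      for g :: "'c \<Rightarrow> 'a set set" and U by blast
    let ?f = "\<lambda>(P, B). insert (insert a B) (P - {B})"
    have "{P. partition_on (insert a A) P \<and> card P = t} =
       {Q \<in> insert {a} ` {P. partition_on A P}. card Q = t} \<union>
       {Q \<in> ?f ` (SIGMA P:{P. partition_on A P}. P). card Q = t}"
      using partitions_insert[OF insert(2)] by blast
    also have "{Q \<in> insert {a} ` {P. partition_on A P}. card Q = t} =
       insert {a} ` {P \<in> {P. partition_on A P}. card (insert {a} P) = t}"
      by (rule filter_image)
    also have "{P \<in> {P. partition_on A P}. card (insert {a} P) = t} =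
       {P. partition_on A P \<and> card P = k}"
      using card1 Suc by (simp cong: conj_cong)
    also have "{Q \<in> ?f ` (SIGMA P:{P. partition_on A P}. P). card Q = t} =
       ?f ` {PB \<in> (SIGMA P:{P. partition_on A P}. P). card (?f PB) = t}"
      by (rule filter_image)
    also have "{PB \<in> (SIGMA P:{P. partition_on A P}. P). card (?f PB) = t} = ?S"
      using card2 by (auto simp: split_beta cong: conj_cong)
    finally have "{P. partition_on (insert a A) P \<and> card P = t} =
       insert {a} ` {P. partition_on A P \<and> card P = k} \<union> ?f ` ?S" .
    moreover have "(insert {a} ` {P. partition_on A P \<and> card P = k}) \<inter> ?f ` ?S = {}"
    proof -
      have "insert {a} P \<noteq> insert (insert a B) (P' - {B})"
        if "partition_on A P'" "B \<in> P'" for P P' B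
      proof -
        have "B \<noteq> {}" "a \<notin> B" using that insert by (auto simp: partition_on_def)
        then have "{a} \<notin> insert (insert a B) (P' - {B})" using notin[OF that(1)] by auto
        then show ?thesis by blast
      qed
      then show ?thesis by (auto simp: disjoint_iff image_iff Bex_def split_beta)
    qed
    moreover have fins: "finite {P. partition_on A P \<and> card P = j}" for j
      by (rule finite_subset[OF _ finitely_many_partition_on[OF insert(1)]]) auto
    moreover have "inj_on ?f ?S"
      by (rule inj_on_subset[OF inj_on_partition_insert_block[OF insert(2)]]) auto
    moreover have "inj_on (insert {a}) {P. partition_on A P \<and> card P = k}"
      using notin(1) by (intro inj_onI) (metis (mono_tags, lifting) insert_ident mem_Collect_eq)
    \<comment> \<open>A partition with \<open>t\<close> blocks offers \<open>t\<close> blocks that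
      \<open>a\<close> can join: the factor in the Stirling recursion.\<close>
    moreover have "card ?S = t * Stirling (card A) t"
      using insert.IH fin fins by (simp add: card_SigmaI)
    moreover have "finite ?S"
      using fin by (intro finite_SigmaI fins) auto
    ultimately show ?thesis
      using insert by (simp add: card_Un_disjoint card_image Suc)
  qed
qed

subsection \<open>Zero-one points on extreme rays of \<open>dWMET\<close>\<close>

lemma cut_dist_nth: "cut_dist S $ i $ j = (if (i \<in> S) = (j \<in> S) then 0 else 1)"
  by (auto simp: cut_dist_def multicut_def)

lemma indicator_vec_nth: "indicator_vec S $ i = (if i \<in> S then 1 else 0)"
  by (simp add: indicator_vec_def)

lemma cut_dist_Compl: "cut_dist (- S) = cut_dist S"
  by (simp add: vec_eq_iff cut_dist_nth)

lemma cut_dist_UNIV: "cut_dist UNIV = 0"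
  by (simp add: vec_eq_iff cut_dist_nth)

section \<open>The inequalities defining \<open>dWMET\<close>\<close>

lemma dWMET_D:
  assumes "(d, w) \<in> dWMET"
  shows "d $ i $ j = d $ j $ i" "d $ i $ i = 0" "d $ i $ j \<le> d $ i $ k + d $ k $ j"
    "0 \<le> d $ i $ j" "0 \<le> w $ i" "w $ i - w $ j \<le> d $ i $ j"
proof -
  have sym: "d $ i $ j = d $ j $ i" and zero: "d $ i $ i = 0"
    and tri: "d $ i $ j \<le> d $ i $ k + d $ k $ j" for i j k
    using assms unfolding dWMET_def semimetric_def by blast+
  show "d $ i $ j = d $ j $ i" "d $ i $ i = 0" "d $ i $ j \<le> d $ i $ k + d $ k $ j"
    by (fact sym zero tri)+
  show "0 \<le> d $ i $ j" using tri[of i i j] sym[of i j] zero[of i] by simp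
  show "0 \<le> w $ i" using assms by (simp add: dWMET_def)
  show "w $ i - w $ j \<le> d $ i $ j"
    using assms zero by (cases "i = j") (auto simp: dWMET_def)
qed

lemma convex_cone_dWMET: "convex_cone (dWMET :: ('n::finite) weighted_dist set)"
proof (intro convex_cone_iff[THEN iffD2] conjI ballI allI impI)
  show "0 \<in> (dWMET :: 'n weighted_dist set)"
    by (simp add: dWMET_def semimetric_def zero_prod_def)
next
  fix x y :: "'n weighted_dist" assume "x \<in> dWMET" "y \<in> dWMET"
  moreover obtain d w e v where "x = (d, w)" "y = (e, v)" by fastforce
  ultimately have xy: "(d, w) \<in> dWMET" "(e, v) \<in> dWMET" "x + y = (d + e, w + v)" by auto
  have "(d + e) $ i $ j \<le> (d + e) $ i $ k + (d + e) $ k $ j" for i j k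
    using dWMET_D(3)[OF xy(1), of i j k] dWMET_D(3)[OF xy(2), of i j k] by simp
  moreover have "(w + v) $ i - (w + v) $ j \<le> (d + e) $ i $ j" for i j
    using dWMET_D(6)[OF xy(1), of i j] dWMET_D(6)[OF xy(2), of i j] by simp
  ultimately show "x + y \<in> dWMET"
    using dWMET_D(1,2,5)[OF xy(1)] dWMET_D(1,2,5)[OF xy(2)]
    unfolding xy(3) dWMET_def semimetric_def by simp
next
  fix x :: "'n weighted_dist" and c :: real assume "x \<in> dWMET" and c: "0 \<le> c"
  moreover obtain d w where "x = (d, w)" by fastforce
  ultimately have x: "(d, w) \<in> dWMET" "c *\<^sub>R x = (c *\<^sub>R d, c *\<^sub>R w)" by auto
  have "(c *\<^sub>R d) $ i $ j \<le> (c *\<^sub>R d) $ i $ k + (c *\<^sub>R d) $ k $ j" for i j k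
    using mult_left_mono[OF dWMET_D(3)[OF x(1), of i j k] c] by (simp add: algebra_simps)
  moreover have "(c *\<^sub>R w) $ i - (c *\<^sub>R w) $ j \<le> (c *\<^sub>R d) $ i $ j" for i j
    using mult_left_mono[OF dWMET_D(6)[OF x(1), of i j] c] by (simp add: algebra_simps)
  ultimately show "c *\<^sub>R x \<in> dWMET"
    using dWMET_D(1,2,5)[OF x(1)] c
    unfolding x(2) dWMET_def semimetric_def by simp
qed

text \<open>The functionals to be fed into \<open>extreme_raysI\<close>. Triangle inequalities enter
  there through the membership of the point in \<open>dWMET\<close> instead of as tight
  functionals.\<close>

lemma linear_dWMET_functionals:
  "linear (\<lambda>x :: ('n::finite) weighted_dist. fst x $ i $ j)"
  "linear (\<lambda>x :: 'n weighted_dist. snd x $ i)"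
  "linear (\<lambda>x :: 'n weighted_dist. fst x $ i $ j - (snd x $ i - snd x $ j))"
  by (auto intro!: linearI simp: algebra_simps)

lemma dWMET_functionals_nonneg:
  "\<forall>x\<in>dWMET. 0 \<le> fst x $ i $ j"
  "\<forall>x\<in>dWMET. 0 \<le> snd x $ i"
  "\<forall>x\<in>dWMET. 0 \<le> fst x $ i $ j - (snd x $ i - snd x $ j)"
  by (auto dest: dWMET_D(4,5,6))

lemma multicut_weight_in_dWMET:
  assumes P: "partition_on UNIV P" and w: "\<And>i. 0 \<le> w $ i \<and> w $ i \<le> 1"
    and const: "\<And>A i j. A \<in> P \<Longrightarrow> i \<in> A \<Longrightarrow> j \<in> A \<Longrightarrow> w $ i = w $ j"
  shows "(multicut P, w) \<in> dWMET"
proof -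
  have part: "\<exists>!A. A \<in> P \<and> i \<in> A" for i
    using P by (auto simp: partition_on_def pairwise_def disjnt_iff)
  \<comment> \<open>Naming the block of each point turns the multicut into the discrete distance
    between names, so the triangle inequality becomes transitivity of equality.\<close>
  have same: "multicut P $ i $ j = (if (THE A. A \<in> P \<and> i \<in> A) = (THE A. A \<in> P \<and> j \<in> A) then 0 else 1)" for i j
    using theI'[OF part[of i]] theI'[OF part[of j]] part[of i] part[of j]
    by (auto simp: multicut_def)
  have "w $ i - w $ j \<le> multicut P $ i $ j" for i j
  proof (cases "\<exists>A\<in>P. i \<in> A \<and> j \<in> A")
    case True
    then obtain A where "A \<in> P" "i \<in> A" "j \<in> A" by blast
    then have "w $ i = w $ j" by (rule const)
    then show ?thesis by (simp add: multicut_def)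
  next
    case False
    then show ?thesis using w[of i] w[of j] by (auto simp: multicut_def)
  qed
  then show ?thesis
    using w unfolding dWMET_def semimetric_def by (auto simp: same)
qed

text \<open>Covers \<open>S = UNIV\<close> as well, where \<open>{S, - S}\<close> contains the empty
  set and is not a partition; the generator with zero distance is of this kind.\<close>

lemma cut_weight_in_dWMET:
  assumes "\<And>i j. (i \<in> S) = (j \<in> S) \<Longrightarrow> w $ i = w $ j" "\<And>i. 0 \<le> w $ i \<and> w $ i \<le> 1"
  shows "(cut_dist S, w) \<in> dWMET"
proof -
  have "w $ i - w $ j \<le> cut_dist S $ i $ j" for i j
    using assms(1)[of i j] assms(2)[of i] assms(2)[of j] by (auto simp: cut_dist_nth)
  moreover have "semimetric (cut_dist S)"
    by (simp add: semimetric_def cut_dist_nth)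
  ultimately show ?thesis
    using assms(2) by (simp add: dWMET_def)
qed

section \<open>Cuts spanning extreme rays, and the converse\<close>

lemma extreme_ray_cut_indicator:
  fixes S :: "'n::finite set"
  assumes "S \<noteq> {}"
  shows "cone hull {(cut_dist S, indicator_vec S)} \<in> extreme_rays (dWMET :: 'n weighted_dist set)"
proof (rule extreme_raysI[OF convex_cone_dWMET])
  let ?v = "(cut_dist S, indicator_vec S) :: 'n weighted_dist"
  show "?v \<in> dWMET" by (rule cut_weight_in_dWMET) (auto simp: indicator_vec_nth)
  obtain s where s: "s \<in> S" using assms by blast
  then have "indicator_vec S $ s \<noteq> (0 :: real)" by (simp add: indicator_vec_nth)
  then show "?v \<noteq> 0" by (auto simp: zero_prod_def)
  fix x :: "'n weighted_dist"
  assume x: "x \<in> dWMET" and tight: "\<And>f :: 'n weighted_dist \<Rightarrow> real.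
    linear f \<Longrightarrow> (\<forall>y\<in>dWMET. 0 \<le> f y) \<Longrightarrow> f ?v = 0 \<Longrightarrow> f x = 0"
  obtain d w where dw: "x = (d, w)" by fastforce
  have same: "d $ i $ j = 0" if "(i \<in> S) = (j \<in> S)" for i j
    using tight[OF linear_dWMET_functionals(1) dWMET_functionals_nonneg(1), of i j] that
    by (simp add: dw cut_dist_nth)
  have out: "w $ i = 0" if "i \<notin> S" for i
    using tight[OF linear_dWMET_functionals(2) dWMET_functionals_nonneg(2), of i] that
    by (simp add: dw indicator_vec_nth)
  have cross: "d $ i $ j = w $ i - w $ j" if "i \<in> S" "j \<notin> S" for i j
    using tight[OF linear_dWMET_functionals(3) dWMET_functionals_nonneg(3), of i j] that
    by (simp add: dw cut_dist_nth indicator_vec_nth)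
  \<comment> \<open>Points of \<open>S\<close> have distance 0, so the weight inequality in both
    directions equates their weights. The common value fixes the distances across the cut and serves
    as the scaling factor.\<close>
  have const: "w $ i = w $ s" if "i \<in> S" for i
    using same[of i s] same[of s i] dWMET_D(6)[OF x[unfolded dw], of i s]
      dWMET_D(6)[OF x[unfolded dw], of s i] that s by simp
  define c where "c = w $ s"
  have "d $ i $ j = c * cut_dist S $ i $ j" for i j
    using same[of i j] cross[of i j] cross[of j i] out[of i] out[of j] const[of i] const[of j]
      dWMET_D(1)[OF x[unfolded dw], of i j]
    by (auto simp: cut_dist_nth c_def)
  then have "d = c *\<^sub>R cut_dist S" by (simp add: vec_eq_iff)
  moreover have "w = c *\<^sub>R indicator_vec S"
    using out const by (auto simp: vec_eq_iff indicator_vec_nth c_def)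
  moreover have "0 \<le> c" using dWMET_D(5)[OF x[unfolded dw]] by (simp add: c_def)
  ultimately show "x \<in> cone hull {?v}"
    unfolding mem_ray_iff dw by (intro exI[of _ c]) simp
qed

lemma extreme_ray_cut_zero:
  fixes S :: "'n::finite set"
  assumes "S \<noteq> {}" "S \<noteq> UNIV"
  shows "cone hull {(cut_dist S, 0)} \<in> extreme_rays (dWMET :: 'n weighted_dist set)"
proof (rule extreme_raysI[OF convex_cone_dWMET])
  let ?v = "(cut_dist S, 0) :: 'n weighted_dist"
  show "?v \<in> dWMET" by (rule cut_weight_in_dWMET) auto
  obtain s t where st: "s \<in> S" "t \<notin> S" using assms by blast
  then have "cut_dist S $ s $ t \<noteq> (0 :: real)" by (simp add: cut_dist_nth)
  then show "?v \<noteq> 0" by (auto simp: zero_prod_def)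
  fix x :: "'n weighted_dist"
  assume x: "x \<in> dWMET" and tight: "\<And>f :: 'n weighted_dist \<Rightarrow> real.
    linear f \<Longrightarrow> (\<forall>y\<in>dWMET. 0 \<le> f y) \<Longrightarrow> f ?v = 0 \<Longrightarrow> f x = 0"
  obtain d w where dw: "x = (d, w)" by fastforce
  note D = dWMET_D[OF x[unfolded dw]]
  have same: "d $ i $ j = 0" if "(i \<in> S) = (j \<in> S)" for i j
    using tight[OF linear_dWMET_functionals(1) dWMET_functionals_nonneg(1), of i j] that
    by (simp add: dw cut_dist_nth)
  have w: "w $ i = 0" for i
    using tight[OF linear_dWMET_functionals(2) dWMET_functionals_nonneg(2), of i]
    by (simp add: dw)
  \<comment> \<open>Moving an endpoint within its side costs nothing: two triangle inequalities
    bound \<open>d $ i $ j\<close> by \<open>d $ s $ t\<close>, the other two give the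
    reverse.\<close>
  have cross: "d $ i $ j = d $ s $ t" if "i \<in> S" "j \<notin> S" for i j
    using D(3)[of i j s] D(3)[of s j t] D(3)[of s t i] D(3)[of i t j]
      same[of i s] same[of s i] same[of t j] same[of j t] that st by simp
  define c where "c = d $ s $ t"
  have "d $ i $ j = c * cut_dist S $ i $ j" for i j
    using same[of i j] cross[of i j] cross[of j i] D(1)[of i j] by (auto simp: cut_dist_nth c_def)
  then have "d = c *\<^sub>R cut_dist S" by (simp add: vec_eq_iff)
  moreover have "0 \<le> c" using D(4) by (simp add: c_def)
  moreover have "w = c *\<^sub>R 0"
    using w by (simp add: vec_eq_iff)
  ultimately show "x \<in> cone hull {?v}"
    unfolding mem_ray_iff dw by (intro exI[of _ c]) simp
qed

text \<open>A triangle with two points in one zero class of \<open>d\<close> is degenerate, since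
  \<open>e\<close> respects the classes. In all others both right-hand terms are at least
  \<open>m\<close> and the left-hand one is at most \<open>2 * m\<close>.\<close>

lemma semimetric_perturb:
  assumes d: "semimetric d" and e_sym: "\<And>i j. e $ i $ j = e $ j $ i"
    and zero: "\<And>i j. d $ i $ j = 0 \<Longrightarrow> e $ i $ j = 0"
    and cls: "\<And>i j k. d $ i $ k = 0 \<Longrightarrow> e $ i $ j = e $ k $ j"
    and rng: "\<And>i j. d $ i $ j \<noteq> 0 \<Longrightarrow> m \<le> e $ i $ j \<and> e $ i $ j \<le> 2 * m"
  shows "semimetric e"
proof -
  have "e $ i $ j \<le> e $ i $ k + e $ k $ j" for i j k
  proof -
    have "d $ k $ j = d $ j $ k" using d unfolding semimetric_def by blast
    then consider "d $ i $ k = 0" | "d $ j $ k = 0" | "d $ i $ j = 0" "d $ i $ k \<noteq> 0" "d $ k $ j \<noteq> 0"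
      | "d $ i $ j \<noteq> 0" "d $ i $ k \<noteq> 0" "d $ k $ j \<noteq> 0"
      by metis
    then show ?thesis
    proof cases
      case 1 then show ?thesis using cls[of i k j] zero[of i k] by simp
    next
      case 2 then show ?thesis using cls[of j k i] zero[of j k] by (simp add: e_sym[of i] e_sym[of k j])
    next
      case 3 then show ?thesis using zero[of i j] rng[of i k] rng[of k j] by linarith
    next
      case 4 then show ?thesis using rng[of i j] rng[of i k] rng[of k j] by linarith
    qed
  qed
  then show ?thesis
    using d e_sym zero by (simp add: semimetric_def)
qed

lemma zero_one_extreme_ray_cases:
  fixes d :: "real^'n::finite^'n"
  assumes R: "R \<in> extreme_rays dWMET" and x: "(d, w) \<in> R" "(d, w) \<noteq> 0" "zero_one_valued (d, w)"
  shows "\<exists>S. S \<noteq> {} \<and> ((d, w) = (cut_dist S, indicator_vec S) \<or>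
    S \<noteq> UNIV \<and> (d, w) = (cut_dist S, 0))"
proof (cases "\<exists>a b. d $ a $ b = 1 \<and> w $ a = w $ b")
  case False
  have dw: "(d, w) \<in> dWMET"
    using R x face_of_imp_subset by (auto simp: extreme_rays_def)
  note D = dWMET_D[OF dw]
  have d01: "d $ i $ j = 0 \<or> d $ i $ j = 1" and w01: "w $ i = 0 \<or> w $ i = 1" for i j
    using x(3) by (auto simp: zero_one_valued_def)
  let ?S = "{i. w $ i = 1}"
  have "w = indicator_vec ?S"
    using w01 by (auto simp: vec_eq_iff indicator_vec_nth)
  moreover have eq: "d $ i $ j = cut_dist ?S $ i $ j" for i j
  \<comment> \<open>Distance 1 forces different weights in this case, and distance 0 forces equal
    ones by the weight inequality, so the weights alone determine the cut.\<close>
  proof -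
    have "d $ i $ j = 1 \<Longrightarrow> w $ i \<noteq> w $ j" using False by blast
    then show ?thesis
      using d01[of i j] w01[of i] w01[of j] D(6)[of i j] D(6)[of j i] D(1)[of i j]
      by (auto simp: cut_dist_nth)
  qed
  then have "d = cut_dist ?S" by (simp add: vec_eq_iff)
  moreover have "?S \<noteq> {}"
  proof
    assume "?S = {}"
    then have "w = 0" "d = 0"
      using w01 eq by (auto simp: vec_eq_iff cut_dist_nth)
    then show False using x(2) by (simp add: zero_prod_def)
  qed
  ultimately show ?thesis by (intro exI[of _ ?S]) simp
next
  case True
  then obtain a b where ab: "d $ a $ b = 1" "w $ a = w $ b" by blast
  have dw: "(d, w) \<in> dWMET"
    using R x face_of_imp_subset by (auto simp: extreme_rays_def)
  note D = dWMET_D[OF dw]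
  have semi: "semimetric d" using dw by (simp add: dWMET_def)
  have d01: "d $ i $ j = 0 \<or> d $ i $ j = 1" and w01: "w $ i = 0 \<or> w $ i = 1" for i j
    using x(3) by (auto simp: zero_one_valued_def)
  have cls: "d $ i $ j = d $ k $ j" if "d $ i $ k = 0" for i j k
    using D(3)[of i j k] D(3)[of k j i] D(1)[of i k] that by simp
  have wclass: "w $ i = w $ j" if "d $ i $ j = 0" for i j
    using D(6)[of i j] D(6)[of j i] D(1)[of i j] that by simp
  \<comment> \<open>Perturb the distance between the classes of \<open>a\<close> and \<open>b\<close>, which carry the same weight.\<close>
  define Q where "Q i j \<longleftrightarrow> d $ a $ i = 0 \<and> d $ b $ j = 0 \<or> d $ a $ j = 0 \<and> d $ b $ i = 0" for i j
  have Qd: "d $ i $ j = 1 \<and> w $ i = w $ j" if "Q i j" for i j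
    using that cls[of a i] cls[of b j] cls[of a j] cls[of b i] ab wclass D(1)
    unfolding Q_def by metis
  have Qclass: "Q i j \<longleftrightarrow> Q k j" if "d $ i $ k = 0" for i j k
    using cls[OF that] D(1) unfolding Q_def by metis
  have Qsym: "Q i j \<longleftrightarrow> Q j i" for i j unfolding Q_def by blast
  define e where "e = (\<chi> i j. if Q i j then 1/2 else (0::real))"
  have mem: "(d + r *\<^sub>R e, w) \<in> dWMET" if r: "r = 1 \<or> r = -1" for r :: real
  proof -
    let ?d = "d + r *\<^sub>R e"
    \<comment> \<open>Nonzero values are 1 and 3/2 for \<open>r = 1\<close>, and 1/2 and 1 for
      \<open>r = -1\<close>; this dictates the two choices of \<open>m\<close>.\<close>
    have "semimetric ?d"
    proof (rule semimetric_perturb[OF semi, where m = "if r = 1 then 1 else 1/2"])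
      show "?d $ i $ j = ?d $ j $ i" for i j using D(1)[of i j] Qsym[of i j] by (simp add: e_def)
      show "?d $ i $ j = 0" if "d $ i $ j = 0" for i j using that Qd[of i j] by (auto simp: e_def)
      show "?d $ i $ j = ?d $ k $ j" if "d $ i $ k = 0" for i j k
        using cls[OF that, of j] Qclass[OF that, of j] by (simp add: e_def)
      show "(if r = 1 then 1 else 1/2) \<le> ?d $ i $ j \<and> ?d $ i $ j \<le> 2 * (if r = 1 then 1 else 1/2)"
        if "d $ i $ j \<noteq> 0" for i j using that r d01[of i j] by (auto simp: e_def)
    qed
    \<comment> \<open>Where the distance moves the two weights agree, so there only nonnegativity is
      required.\<close>
    moreover have "w $ i - w $ j \<le> ?d $ i $ j" for i j
      using Qd[of i j] D(6)[of i j] r by (auto simp: e_def)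
    ultimately show ?thesis using D(5) by (simp add: dWMET_def)
  qed
  have "(d, w) + (e, 0) \<in> dWMET" "(d, w) - (e, 0) \<in> dWMET"
    using mem[of 1] mem[of "-1"] by simp_all
  from extreme_rays_perturb[OF R x(1,2) this]
  obtain c where c: "e = c *\<^sub>R d" "c *\<^sub>R w = 0" by auto
  \<comment> \<open>Comparison at the pair \<open>a\<close>, \<open>b\<close> fixes the factor of
    proportionality. It is nonzero, so the weights vanish, and all unit distances turn out to be
    perturbed ones.\<close>
  have "Q a b" using D(2) by (simp add: Q_def)
  then have "e $ a $ b = 1/2" by (simp add: e_def)
  then have "c = 1/2" using c(1) ab(1) by simp
  then have w: "w = 0" and Qiff: "Q i j \<longleftrightarrow> d $ i $ j = 1" for i j
  proof -
    have "e $ i $ j = d $ i $ j / 2" using c(1) \<open>c = 1/2\<close> by simp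
    then show "Q i j \<longleftrightarrow> d $ i $ j = 1" using d01[of i j] by (auto simp: e_def split: if_splits)
  qed (use c(2) \<open>c = 1/2\<close> in simp)
  \<comment> \<open>The zero class of \<open>a\<close> is one side. Every unit distance joins it to
    the class of \<open>b\<close>, so all remaining points lie at distance 0 from each
    other.\<close>
  define S where "S = {i. d $ a $ i = 0}"
  have "d $ i $ j = cut_dist S $ i $ j" for i j
  proof (cases "d $ i $ j = 1")
    case True
    then have "Q i j" by (simp add: Qiff)
    then have "d $ a $ i = 0 \<and> d $ a $ j = 1 \<or> d $ a $ j = 0 \<and> d $ a $ i = 1"
      using ab(1) cls[of b i a] cls[of b j a] D(1)[of b a] D(1)[of j a] D(1)[of i a]
      unfolding Q_def by auto
    then show ?thesis using d01[of a i] d01[of a j] True by (auto simp: cut_dist_nth S_def)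
  next
    case False
    then have "d $ i $ j = 0" using d01[of i j] by simp
    moreover from this have "d $ a $ i = d $ a $ j"
      using cls[of i j a] D(1)[of i a] D(1)[of j a] by simp
    ultimately show ?thesis by (simp add: cut_dist_nth S_def)
  qed
  then have "d = cut_dist S" by (simp add: vec_eq_iff)
  moreover have "a \<in> S" "b \<notin> S" using ab D(2) by (simp_all add: S_def)
  ultimately show ?thesis using w by (intro exI[of _ S]) auto
qed

subsection \<open>Counting zero-one points\<close>

lemma multicut_eq_zero_iff:
  "multicut P $ i $ j = 0 \<longleftrightarrow> (\<exists>A\<in>P. i \<in> A \<and> j \<in> A)"
  by (simp add: multicut_def)

text \<open>A multicut determines its partition, the blocks being its zero classes. Writing them as
  a range over the points also bounds their number by \<open>CARD('n)\<close>.\<close>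

lemma partition_eq_range_multicut:
  fixes P :: "'n::finite set set"
  assumes P: "partition_on UNIV P"
  shows "P = range (\<lambda>i. {j. multicut P $ i $ j = 0})"
proof -
  have block: "{j. multicut P $ i $ j = 0} = A" if A: "A \<in> P" "i \<in> A" for A i
  proof -
    have "B = A" if "B \<in> P" "i \<in> B" for B
      using P that A unfolding partition_on_def pairwise_def disjnt_iff by metis
    then show ?thesis using A unfolding multicut_eq_zero_iff by blast
  qed
  have "A \<in> range (\<lambda>i. {j. multicut P $ i $ j = 0})" if A: "A \<in> P" for A
  proof -
    obtain i where "i \<in> A" using P A unfolding partition_on_def by (metis all_not_in_conv)
    then show ?thesis using block[OF A] by blast
  qed
  moreover have "{j. multicut P $ i $ j = 0} \<in> P" for i
  proof -
    obtain A where "A \<in> P" "i \<in> A" using P unfolding partition_on_def by (metis UNIV_I UnionE)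
    then show ?thesis using block by simp
  qed
  ultimately show ?thesis by blast
qed

text \<open>By the triangle inequality, distance 0 is an equivalence relation; its classes are the
  blocks, and the weight inequality in both directions makes weights constant on them.\<close>

lemma zero_one_dWMET_eq:
  "{x \<in> (dWMET :: ('n::finite) weighted_dist set). zero_one_valued x} =
     {(multicut P, w) | P w. partition_on UNIV P \<and> (\<forall>i. w $ i \<in> {0, 1}) \<and>
                             (\<forall>A\<in>P. \<forall>i\<in>A. \<forall>j\<in>A. w $ i = w $ j)}" (is "?L = ?R")
proof
  show "?L \<subseteq> ?R"
  proof
    fix x :: "'n weighted_dist" assume "x \<in> ?L"
    moreover obtain d w where x: "x = (d, w)" by fastforce
    ultimately have dw: "(d, w) \<in> dWMET" and d01: "\<And>i j. d $ i $ j = 0 \<or> d $ i $ j = 1"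
      and w01: "\<And>i. w $ i \<in> {0, 1}"
      by (auto simp: zero_one_valued_def)
    note D = dWMET_D[OF dw]
    define c where "c i = {j. d $ i $ j = 0}" for i
    have c_mem: "j \<in> c i \<longleftrightarrow> d $ i $ j = 0" for i j by (simp add: c_def)
    have c_eq: "c i = c j" if "d $ i $ j = 0" for i j
    proof -
      have "d $ i $ k = d $ j $ k" for k
        using D(3)[of i k j] D(3)[of j k i] D(1)[of i j] that by simp
      then show ?thesis by (simp add: c_def)
    qed
    have w_eq: "w $ i = w $ j" if "d $ i $ j = 0" for i j
      using D(6)[of i j] D(6)[of j i] D(1)[of i j] that by simp
    have "partition_on UNIV (range c)"
    proof (rule partition_onI)
      show "\<Union>(range c) = UNIV" using c_mem D(2) by blast
      show "{} \<notin> range c" using c_mem D(2) by (metis empty_iff rangeE)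
      fix p q assume "p \<in> range c" "q \<in> range c" "p \<noteq> q"
      then obtain i j where ij: "p = c i" "q = c j" "c i \<noteq> c j" by blast
      have "\<not> (k \<in> c i \<and> k \<in> c j)" for k
        using c_eq[of i k] c_eq[of j k] ij(3) by (auto simp: c_mem)
      then show "disjnt p q" by (simp add: ij disjnt_iff)
    qed
    moreover have "d = multicut (range c)"
    proof -
      have "(\<exists>A\<in>range c. i \<in> A \<and> j \<in> A) \<longleftrightarrow> d $ i $ j = 0" for i j
      proof
        assume "\<exists>A\<in>range c. i \<in> A \<and> j \<in> A"
        then obtain k where k: "i \<in> c k" "j \<in> c k" by blast
        then have "c k = c i" using c_eq[of k i] by (simp add: c_mem)
        then show "d $ i $ j = 0" using k by (simp add: c_mem)
      next
        assume "d $ i $ j = 0"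
        then have "i \<in> c i" "j \<in> c i" using D(2) by (simp_all add: c_mem)
        then show "\<exists>A\<in>range c. i \<in> A \<and> j \<in> A" by blast
      qed
      then have "d $ i $ j = multicut (range c) $ i $ j" for i j
        using d01[of i j] by (auto simp: multicut_def)
      then show ?thesis unfolding vec_eq_iff by blast
    qed
    moreover have "\<forall>A\<in>range c. \<forall>i\<in>A. \<forall>j\<in>A. w $ i = w $ j"
    proof clarify
      fix k i j assume "i \<in> c k" "j \<in> c k"
      then have "w $ k = w $ i" "w $ k = w $ j"
        using w_eq[of k i] w_eq[of k j] by (simp_all add: c_mem)
      then show "w $ i = w $ j" by simp
    qed
    ultimately show "x \<in> ?R" using w01 x by blast
  qed
next
  show "?R \<subseteq> ?L"
  proof
    fix x :: "'n weighted_dist" assume "x \<in> ?R"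
    then obtain P w where x: "x = (multicut P, w)" and P: "partition_on UNIV P"
      and w: "\<forall>i. w $ i \<in> {0, 1}" and const: "\<forall>A\<in>P. \<forall>i\<in>A. \<forall>j\<in>A. w $ i = w $ j" by blast
    have "0 \<le> w $ i \<and> w $ i \<le> 1" for i using spec[OF w, of i] by auto
    then have "(multicut P, w) \<in> dWMET"
      using multicut_weight_in_dWMET[OF P, of w] const by blast
    moreover have "zero_one_valued (multicut P, w)"
      using w by (simp add: zero_one_valued_def multicut_def)
    ultimately show "x \<in> ?L" using x by simp
  qed
qed

section \<open>Zero-one weights as sets of blocks\<close>

lemma indicator_vec_eq_iff: "indicator_vec S = indicator_vec T \<longleftrightarrow> S = T"
proof
  assume "indicator_vec S = indicator_vec T"
  then have "indicator_vec S $ i = (indicator_vec T $ i :: real)" for i by simp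
  then have "i \<in> S \<longleftrightarrow> i \<in> T" for i unfolding indicator_vec_nth by (metis zero_neq_one)
  then show "S = T" by blast
qed simp

lemma indicator_vec_empty: "indicator_vec {} = 0"
  by (simp add: vec_eq_iff indicator_vec_nth)

text \<open>Blocks are nonempty and disjoint, so a family of blocks can be read off from its union.
  This makes the parametrization of weights by families injective.\<close>

lemma Union_subset_partition_eq:
  assumes P: "partition_on A P" and Q: "Q \<subseteq> P"
  shows "Q = {B \<in> P. B \<subseteq> \<Union>Q}"
proof (intro equalityI subsetI)
  fix B assume B: "B \<in> {B \<in> P. B \<subseteq> \<Union>Q}"
  then obtain b where b: "b \<in> B" using P unfolding partition_on_def by (metis all_not_in_conv mem_Collect_eq)
  then obtain C where C: "C \<in> Q" "b \<in> C" using B by blast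
  then have "B = C"
    using P B Q b unfolding partition_on_def pairwise_def disjnt_iff by (metis (no_types, lifting) mem_Collect_eq subsetD)
  then show "B \<in> Q" using C by simp
qed (use Q in auto)

text \<open>\<open>Q\<close> collects the blocks of weight 1. Replacing weights by subsets of
  \<open>P\<close> reduces the count to the size of a power set.\<close>

lemma zero_one_dWMET_eq_image:
  "{(multicut P, w) | P w. partition_on UNIV P \<and> (\<forall>i. w $ i \<in> {0, 1}) \<and>
                             (\<forall>A\<in>P. \<forall>i\<in>A. \<forall>j\<in>A. w $ i = w $ j)} =
   (\<lambda>(P, Q). (multicut P, indicator_vec (\<Union>Q)) :: ('n::finite) weighted_dist) `
     (SIGMA P:{P. partition_on UNIV P}. Pow P)" (is "?L = ?f ` ?S")
proof (intro equalityI subsetI)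
  fix x :: "'n weighted_dist" assume "x \<in> ?L"
  then obtain P w where x: "x = (multicut P, w)" and P: "partition_on UNIV P"
    and w: "\<And>i. w $ i \<in> {0, 1}" and const: "\<forall>A\<in>P. \<forall>i\<in>A. \<forall>j\<in>A. w $ i = w $ j" by blast
  define Q where "Q = {A \<in> P. \<exists>i\<in>A. w $ i = 1}"
  have "i \<in> \<Union>Q \<longleftrightarrow> w $ i = 1" for i
  proof
    assume "i \<in> \<Union>Q"
    then obtain A j where "A \<in> P" "i \<in> A" "j \<in> A" "w $ j = 1" by (auto simp: Q_def)
    then show "w $ i = 1" using const by metis
  next
    assume i: "w $ i = 1"
    obtain A where "A \<in> P" "i \<in> A" using P unfolding partition_on_def by (metis UNIV_I UnionE)
    then show "i \<in> \<Union>Q" using i by (auto simp: Q_def)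
  qed
  then have "w $ i = indicator_vec (\<Union>Q) $ i" for i
    using w[of i] by (auto simp: indicator_vec_nth)
  then have "w = indicator_vec (\<Union>Q)" unfolding vec_eq_iff by blast
  moreover have "(P, Q) \<in> ?S" using P by (auto simp: Q_def)
  ultimately show "x \<in> ?f ` ?S" using x by (intro image_eqI[of _ _ "(P, Q)"]) simp_all
next
  fix x :: "'n weighted_dist" assume "x \<in> ?f ` ?S"
  then obtain P Q where x: "x = (multicut P, indicator_vec (\<Union>Q))"
    and P: "partition_on UNIV P" and Q: "Q \<subseteq> P" by auto
  have same: "(i \<in> \<Union>Q) = (j \<in> \<Union>Q)" if A: "A \<in> P" "i \<in> A" "j \<in> A" for A i j
  proof -
    have "B = A" if "B \<in> P" "i \<in> B \<or> j \<in> B" for B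
      using P A that unfolding partition_on_def pairwise_def disjnt_iff by metis
    then have "B = A" if "B \<in> Q" "i \<in> B \<or> j \<in> B" for B
      using that Q by (meson subsetD)
    then show ?thesis using A by blast
  qed
  have "\<forall>A\<in>P. \<forall>i\<in>A. \<forall>j\<in>A. indicator_vec (\<Union>Q) $ i = (indicator_vec (\<Union>Q) $ j :: real)"
  proof (intro ballI)
    fix A i j assume "A \<in> P" "i \<in> A" "j \<in> A"
    from same[OF this] show "indicator_vec (\<Union>Q) $ i = (indicator_vec (\<Union>Q) $ j :: real)"
      by (simp only: indicator_vec_nth)
  qed
  moreover have "\<forall>i. indicator_vec (\<Union>Q) $ i \<in> {0, 1 :: real}"
    by (simp add: indicator_vec_nth)
  ultimately show "x \<in> ?L" using x P by blast
qed

lemma card_zero_one_dWMET: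
  "card {x \<in> (dWMET :: ('n::finite) weighted_dist set). zero_one_valued x} =
     (\<Sum>t = 1..CARD('n). 2 ^ t * Stirling CARD('n) t)"
proof -
  let ?parts = "{P :: 'n set set. partition_on UNIV P}"
  let ?f = "\<lambda>(P, Q). (multicut P, indicator_vec (\<Union>Q)) :: 'n weighted_dist"
  have fin: "finite ?parts" by (rule finitely_many_partition_on) simp
  have "inj_on ?f (SIGMA P:?parts. Pow P)"
  proof (rule inj_onI; clarify)
    fix P Q P' Q' :: "'n set set"
    assume P: "partition_on UNIV P" "Q \<subseteq> P" and P': "partition_on UNIV P'" "Q' \<subseteq> P'"
      and eq: "multicut P = (multicut P' :: real^'n^'n)" "indicator_vec (\<Union>Q) = (indicator_vec (\<Union>Q') :: real^'n)"
    have PP: "P = P'"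
      using partition_eq_range_multicut[OF P(1)] partition_eq_range_multicut[OF P'(1)] eq(1) by simp
    have "\<Union>Q = \<Union>Q'" using eq(2) by (simp only: indicator_vec_eq_iff)
    then have "Q = Q'"
      using Union_subset_partition_eq[OF P] Union_subset_partition_eq[OF P'] PP by simp
    then show "P = P' \<and> Q = Q'" using PP by simp
  qed
  then have "card {x \<in> (dWMET :: 'n weighted_dist set). zero_one_valued x} =
      card (SIGMA P:?parts. Pow P)"
    unfolding zero_one_dWMET_eq zero_one_dWMET_eq_image by (rule card_image)
  also have "\<dots> = (\<Sum>P\<in>?parts. 2 ^ card P)"
    using fin by (simp add: card_SigmaI card_Pow)
  also have "\<dots> = (\<Sum>t = 1..CARD('n). \<Sum>P\<in>{P \<in> ?parts. card P = t}. 2 ^ card P)"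
  proof (rule sum.group[symmetric, OF fin])
    \<comment> \<open>The sum can start at 1 because the ground set is nonempty.\<close>
    have "1 \<le> card P \<and> card P \<le> CARD('n)" if P: "partition_on UNIV P" for P :: "'n set set"
    proof -
      have "P \<noteq> {}" using P by (auto simp: partition_on_def)
      then have "1 \<le> card P" by (simp add: Suc_le_eq card_gt_0_iff)
      moreover have "card P \<le> CARD('n)"
        by (subst partition_eq_range_multicut[OF P]) (simp add: card_image_le)
      ultimately show ?thesis by simp
    qed
    then show "card ` ?parts \<subseteq> {1..CARD('n)}" by auto
  qed simp
  also have "\<dots> = (\<Sum>t = 1..CARD('n). 2 ^ t * Stirling CARD('n) t)"
  proof (rule sum.cong[OF refl])
    fix t
    have "(\<Sum>P\<in>{P \<in> ?parts. card P = t}. 2 ^ card P) = 2 ^ t * card {P \<in> ?parts. card P = t}"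
      by (simp cong: conj_cong)
    then show "(\<Sum>P\<in>{P \<in> ?parts. card P = t}. 2 ^ card P) = 2 ^ t * Stirling CARD('n) t"
      using card_partitions_eq_Stirling[of "UNIV :: 'n set" t] by simp
  qed
  finally show ?thesis .
qed

subsection \<open>The extreme rays and their orbits\<close>

abbreviation ray :: "'a::real_vector \<Rightarrow> 'a set" where
  "ray v \<equiv> cone hull {v}"

text \<open>The generator \<open>(0; (1,\<dots>,1))\<close> is the instance \<open>S = UNIV\<close> of \<open>(\<delta>(S); 1\<^sub>S)\<close>, and replacing
  \<open>S\<close> by its complement turns \<open>(\<delta>(S); w')\<close> into \<open>(\<delta>(S); w'')\<close>.\<close>

definition cut_vectors :: "('n::finite) weighted_dist set" where
  "cut_vectors = (\<lambda>S. (cut_dist S, indicator_vec S)) ` (- {{}}) \<union>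
                 (\<lambda>S. (cut_dist S, 0)) ` (- {{}, UNIV})"

lemma ray_image_cut_vectors:
  "ray ` (cut_vectors :: ('n::finite) weighted_dist set) =
     insert (cone hull {(0, indicator_vec UNIV)})
       (\<Union>S \<in> {S. S \<noteq> {} \<and> S \<subset> UNIV}.
          {cone hull {(cut_dist S, 0)},
           cone hull {(cut_dist S, indicator_vec S)},
           cone hull {(cut_dist S, indicator_vec (- S))}})" (is "?L = ?R")
proof
  show "?L \<subseteq> ?R"
  proof
    fix R :: "'n weighted_dist set" assume "R \<in> ?L"
    then consider S where "S \<noteq> {}" "R = ray (cut_dist S, indicator_vec S)"
      | S where "S \<noteq> {}" "S \<noteq> UNIV" "R = ray (cut_dist S, 0)"
      unfolding cut_vectors_def by blast
    then show "R \<in> ?R"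
    proof cases
      case (1 S)
      then show ?thesis by (cases "S = UNIV") (auto simp: cut_dist_UNIV)
    qed auto
  qed
  show "?R \<subseteq> ?L"
  proof
    fix R :: "'n weighted_dist set" assume "R \<in> ?R"
    then consider "R = ray (cut_dist UNIV, indicator_vec UNIV)"
      | S where "S \<noteq> {}" "S \<noteq> UNIV" "R = ray (cut_dist S, 0)"
      | S where "S \<noteq> {}" "S \<noteq> UNIV" "R = ray (cut_dist S, indicator_vec S)"
      | S where "- S \<noteq> {}" "R = ray (cut_dist (- S), indicator_vec (- S))"
      unfolding cut_dist_UNIV cut_dist_Compl by blast
    then show "R \<in> ?L"
      unfolding cut_vectors_def by cases blast+
  qed
qed

lemma indicator_vec_eq_zero_iff: "indicator_vec S = 0 \<longleftrightarrow> S = {}"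
  by (metis indicator_vec_empty indicator_vec_eq_iff)

text \<open>A cut records only whether two points lie on the same side. A point where
  \<open>S\<close> and \<open>T\<close> agree transfers this agreement to every other point; if
  there is none, the sets are complementary.\<close>

lemma cut_dist_eq_iff: "cut_dist S = cut_dist T \<longleftrightarrow> T = S \<or> T = - S"
proof
  assume eq: "cut_dist S = cut_dist T"
  have iff: "(i \<in> S) = (j \<in> S) \<longleftrightarrow> (i \<in> T) = (j \<in> T)" for i j
  proof -
    have "cut_dist S $ i $ j = (cut_dist T $ i $ j :: real)" using eq by simp
    then show ?thesis unfolding cut_dist_nth by (metis zero_neq_one)
  qed
  show "T = S \<or> T = - S"
  proof (cases "\<exists>a. (a \<in> S) = (a \<in> T)")
    case True
    then obtain a where "(a \<in> S) = (a \<in> T)" ..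
    then have "(i \<in> T) = (i \<in> S)" for i using iff[of a i] by argo
    then show ?thesis by blast
  qed blast
qed (auto simp: cut_dist_Compl)

lemma cut_vectors_cases:
  assumes "x \<in> cut_vectors"
  obtains (indicator) S where "S \<noteq> {}" "x = (cut_dist S, indicator_vec S)"
    | (zero) S where "S \<noteq> {}" "S \<noteq> UNIV" "x = (cut_dist S, 0)"
  using assms unfolding cut_vectors_def by blast

lemma cut_vectors_zero_one:
  assumes "x \<in> cut_vectors"
  shows "x \<noteq> 0" "zero_one_valued x"
proof -
  show "zero_one_valued x"
    using assms by (auto simp: cut_vectors_def zero_one_valued_def cut_dist_nth indicator_vec_nth
        split: if_splits)
  have "cut_dist S \<noteq> cut_dist UNIV" if "S \<noteq> {}" "S \<noteq> UNIV" for S :: "'a set"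
    using that unfolding cut_dist_eq_iff by auto
  with assms show "x \<noteq> 0"
    by (cases rule: cut_vectors_cases) (simp_all add: zero_prod_def indicator_vec_eq_zero_iff cut_dist_UNIV)
qed

text \<open>A nonzero coordinate of \<open>x\<close> is 1, and its multiple by the nonzero
  \<open>c\<close> must again be 1. Hence rays may be counted by their zero-one points.\<close>

lemma zero_one_valued_scaleR_eq:
  assumes x: "zero_one_valued x" "x \<noteq> 0" and y: "zero_one_valued y" "y = c *\<^sub>R x" "y \<noteq> 0"
  shows "y = x"
proof -
  obtain d w where dw: "x = (d, w)" by fastforce
  have "c \<noteq> 0" using y by auto
  have d01: "d $ i $ j \<in> {0, 1}" "c * d $ i $ j \<in> {0, 1}" for i j
    using x(1) y(1) unfolding y(2) dw by (auto simp: zero_one_valued_def)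
  have w01: "w $ i \<in> {0, 1}" "c * w $ i \<in> {0, 1}" for i
    using x(1) y(1) unfolding y(2) dw by (auto simp: zero_one_valued_def)
  have "\<exists>r. r \<noteq> 0 \<and> r \<in> {0, 1} \<and> c * r \<in> {0, 1}"
  proof (cases "w = 0")
    case True
    then have "d \<noteq> 0" using x dw by (auto simp: zero_prod_def)
    then obtain i j where "d $ i $ j \<noteq> 0" by (auto simp: vec_eq_iff)
    then show ?thesis using d01 by blast
  next
    case False
    then obtain i where "w $ i \<noteq> 0" by (auto simp: vec_eq_iff)
    then show ?thesis using w01 by blast
  qed
  then have "c = 1" using \<open>c \<noteq> 0\<close> by auto
  then show ?thesis using y by simp
qed

lemma inj_on_ray_cut_vectors: "inj_on ray cut_vectors"
proof (rule inj_onI)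
  fix x y :: "'a weighted_dist"
  assume x: "x \<in> cut_vectors" and y: "y \<in> cut_vectors" and "ray x = ray y"
  then have "y \<in> ray x" by (metis hull_inc singletonI)
  then obtain c where "y = c *\<^sub>R x" unfolding mem_ray_iff by blast
  then show "x = y"
    using zero_one_valued_scaleR_eq cut_vectors_zero_one x y by metis
qed

lemma extreme_rays_zero_one_dWMET:
  "extreme_rays (zero_one_dWMET :: ('n::finite) weighted_dist set) = ray ` cut_vectors"
proof -
  have "{R \<in> extreme_rays dWMET. \<exists>x\<in>R. x \<noteq> 0 \<and> zero_one_valued x} =
    ray ` (cut_vectors :: 'n weighted_dist set)" (is "?L = ?R")
  proof
    show "?L \<subseteq> ?R"
    proof
      fix R :: "'n weighted_dist set" assume "R \<in> ?L"
      then obtain x where R: "R \<in> extreme_rays dWMET" and x: "x \<in> R" "x \<noteq> 0" "zero_one_valued x"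
        by blast
      obtain d w where dw: "x = (d, w)" by fastforce
      have "x \<in> cut_vectors"
        using zero_one_extreme_ray_cases[OF R x[unfolded dw]] unfolding cut_vectors_def dw by blast
      then show "R \<in> ?R" using extreme_rays_iff_mem[OF R x(1,2)] by blast
    qed
    show "?R \<subseteq> ?L"
    proof
      fix R :: "'n weighted_dist set" assume "R \<in> ?R"
      then obtain x where x: "x \<in> cut_vectors" "R = ray x" by blast
      from x(1) have "R \<in> extreme_rays dWMET"
        unfolding x(2)
        by (cases rule: cut_vectors_cases)
          (simp_all add: extreme_ray_cut_indicator extreme_ray_cut_zero)
      moreover have "x \<in> R" using x by (simp add: hull_inc)
      ultimately show "R \<in> ?L" using cut_vectors_zero_one[OF x(1)] by blast
    qed
  qed
  then have "zero_one_dWMET = convex_cone hull \<Union>(ray ` (cut_vectors :: 'n weighted_dist set))"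
    and "ray ` (cut_vectors :: 'n weighted_dist set) \<subseteq> extreme_rays dWMET"
    unfolding zero_one_cone_def by auto
  then show ?thesis using extreme_rays_convex_cone_hull[OF convex_cone_dWMET] by simp
qed

text \<open>The indicator weight determines \<open>S\<close>, giving 2^n - 1 vectors for nonempty
  \<open>S\<close>; with weight 0 only the unordered cut remains, giving 2^(n-1) - 1 more.\<close>

lemma card_cut_vectors:
  "card (cut_vectors :: ('n::finite) weighted_dist set) = 1 + 3 * (2 ^ (CARD('n) - 1) - 1)"
proof -
  let ?A = "(\<lambda>S. (cut_dist S, indicator_vec S)) ` (- {{}}) :: 'n weighted_dist set"
  let ?B = "(\<lambda>S. (cut_dist S, 0)) ` (- {{}, UNIV}) :: 'n weighted_dist set"
  have "card ?A = card (- {{}} :: 'n set set)"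
    by (rule card_image) (simp add: inj_on_def indicator_vec_eq_iff)
  then have A: "card ?A = 2 ^ CARD('n) - 1"
    by (simp add: Compl_eq_Diff_UNIV card_Diff_singleton card_UNIV_set)
  \<comment> \<open>Each cut has exactly one side avoiding \<open>a\<close>.\<close>
  obtain a :: 'n where True by simp
  let ?side = "Pow (- {a}) - {{}} :: 'n set set"
  have "?B = (\<lambda>S. (cut_dist S, 0)) ` ?side"
  proof (intro equalityI subsetI)
    fix x assume "x \<in> ?B"
    then obtain S where S: "S \<noteq> {}" "S \<noteq> UNIV" "x = (cut_dist S, 0)" by blast
    show "x \<in> (\<lambda>S. (cut_dist S, 0)) ` ?side"
    proof (cases "a \<in> S")
      case True
      then show ?thesis using S by (intro image_eqI[of _ _ "- S"]) (auto simp: cut_dist_Compl)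
    next
      case False
      then show ?thesis using S by (intro image_eqI[of _ _ S]) auto
    qed
  qed auto
  moreover have "inj_on (\<lambda>S. (cut_dist S, 0) :: 'n weighted_dist) ?side"
    by (rule inj_onI) (auto simp: cut_dist_eq_iff)
  ultimately have "card ?B = card ?side" by (simp add: card_image)
  then have B: "card ?B = 2 ^ (CARD('n) - 1) - 1"
    by (simp add: card_Diff_singleton card_Pow Compl_eq_Diff_UNIV)
  have "?A \<inter> ?B = {}" by (auto simp: indicator_vec_eq_zero_iff)
  then have "card (cut_vectors :: 'n weighted_dist set) = card ?A + card ?B"
    unfolding cut_vectors_def by (intro card_Un_disjoint) simp_all
  also have "\<dots> = 1 + 3 * (2 ^ (CARD('n) - 1) - 1)"
  proof -
    \<comment> \<open>Successor forms of the cardinality and of the power remove the truncated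
      subtractions.\<close>
    obtain m where m: "CARD('n) = Suc m" by (metis not0_implies_Suc zero_less_card_finite less_irrefl)
    obtain k :: nat where "2 ^ m = Suc k" by (metis not0_implies_Suc power_not_zero zero_neq_numeral)
    then show ?thesis unfolding A B m by simp
  qed
  finally show ?thesis .
qed

section \<open>Orbits of the symmetric group\<close>

lemma card_Compl_eq:
  fixes S :: "'n::finite set"
  shows "card (- S) = CARD('n) - card S"
  by (simp add: Compl_eq_Diff_UNIV card_Diff_subset)

lemma ex_bij_image_eq:
  fixes S T :: "'n::finite set"
  assumes "card S = card T"
  shows "\<exists>p. bij p \<and> p ` S = T"
proof -
  obtain f where f: "bij_betw f S T"
    using assms finite_same_card_bij by (metis finite)
  have "card (- S) = card (- T)" using assms by (simp add: card_Compl_eq)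
  then obtain g where g: "bij_betw g (- S) (- T)"
    using finite_same_card_bij by (metis finite)
  let ?p = "\<lambda>x. if x \<in> S then f x else g x"
  have "bij_betw ?p (S \<union> - S) (T \<union> - T)"
    by (rule bij_betw_disjoint_Un[OF f g]) auto
  moreover have "?p ` S = T" using f by (simp add: bij_betw_def)
  ultimately show ?thesis by (metis Compl_partition)
qed

lemma relabel_cut:
  assumes "bij p"
  shows "relabel p (cut_dist S, indicator_vec T) = (cut_dist (p ` S), indicator_vec (p ` T))"
proof -
  have "inv_into UNIV p i \<in> U \<longleftrightarrow> i \<in> p ` U" for i U
    using assms by (metis bij_inv_eq_iff imageE image_eqI)
  then show ?thesis
    by (simp add: relabel_def vec_eq_iff cut_dist_nth indicator_vec_nth)
qed

lemma relabel_image_ray: "relabel p ` ray x = ray (relabel p x)"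
proof -
  have "relabel p (c *\<^sub>R x) = c *\<^sub>R relabel p x" for c
    by (cases x) (simp add: relabel_def vec_eq_iff)
  then show ?thesis unfolding set_eq_iff image_iff Bex_def mem_ray_iff by metis
qed

text \<open>Permutations act transitively on the subsets of a given size, so the size of
  \<open>S\<close> describes the orbit.\<close>

lemma orbit_ray_cut:
  fixes S :: "'n::finite set"
  shows "orbit (BijGroup (UNIV :: 'n set)) (\<lambda>p R. relabel p ` R) (ray (cut_dist S, indicator_vec S)) =
      (\<lambda>T. ray (cut_dist T, indicator_vec T)) ` {T. card T = card S}" (is ?ind)
    and "orbit (BijGroup (UNIV :: 'n set)) (\<lambda>p R. relabel p ` R) (ray (cut_dist S, 0)) =
      (\<lambda>T. ray (cut_dist T, 0)) ` {T. card T = card S}" (is ?zero)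
proof -
  have images: "{T :: 'n set. card T = card S} = (\<lambda>p. p ` S) ` {p. bij p}"
  proof (intro equalityI subsetI)
    fix T :: "'n set" assume "T \<in> {T. card T = card S}"
    then show "T \<in> (\<lambda>p. p ` S) ` {p. bij p}" using ex_bij_image_eq[of S T] by auto
  next
    fix T :: "'n set" assume "T \<in> (\<lambda>p. p ` S) ` {p. bij p}"
    then show "T \<in> {T. card T = card S}"
      by (auto intro!: card_image intro: inj_on_subset dest: bij_is_inj)
  qed
  have "carrier (BijGroup (UNIV :: 'n set)) = {p. bij p}"
    by (simp add: BijGroup_def Bij_def extensional_def)
  then have orbit: "orbit (BijGroup (UNIV :: 'n set)) (\<lambda>p R. relabel p ` R) (ray x) =
      (\<lambda>p. ray (relabel p x)) ` {p. bij p}" for x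
    unfolding orbit_def relabel_image_ray by blast
  show ?ind
    unfolding orbit images image_image by (intro image_cong refl) (simp add: relabel_cut)
  \<comment> \<open>The zero weight is the indicator of the empty set, which every permutation
    fixes.\<close>
  have "relabel p (cut_dist S, 0) = (cut_dist (p ` S), 0)" if "bij p" for p
    using relabel_cut[OF that, of S "{}"] by (simp add: indicator_vec_empty)
  then show ?zero
    unfolding orbit images image_image by (intro image_cong refl) simp
qed

text \<open>With indicator weight the sizes 1 to n give n different orbits. With weight 0 a cut does
  not distinguish its sides, so sizes k and n - k coincide and the size of the smaller side is the
  invariant, giving n div 2 further orbits.\<close>

lemma card_orbits_ray_cut_vectors:
  "card (orbits (BijGroup (UNIV :: 'n set)) (ray ` (cut_vectors :: ('n::finite) weighted_dist set))
     (\<lambda>p R. relabel p ` R)) = 3 * CARD('n) div 2"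
proof -
  let ?n = "CARD('n)"
  define F where "F k = (\<lambda>T :: 'n set. ray (cut_dist T, indicator_vec T)) ` {T. card T = k}" for k
  define H where "H k = (\<lambda>T :: 'n set. ray (cut_dist T, 0 :: real^'n)) ` {T. card T = k}" for k
  note inj = inj_onD[OF inj_on_ray_cut_vectors]
  have ex: "\<exists>S :: 'n set. card S = k" if "k \<le> ?n" for k
    using obtain_subset_with_card_n[OF that] by blast
  have nonempty: "S \<noteq> {}" if "1 \<le> card S" for S :: "'n set" using that by auto
  have nonfull: "S \<noteq> UNIV" if "card S < ?n" for S :: "'n set" using that by auto
  have Hsym: "H (?n - k) = H k" if "k \<le> ?n" for k
  proof -
    have sub: "H (?n - k) \<subseteq> H k" if "k \<le> ?n" for k
    proof
      fix R assume "R \<in> H (?n - k)"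
      then obtain T where T: "card T = ?n - k" "R = ray (cut_dist (- T), 0)"
        by (auto simp: H_def cut_dist_Compl)
      then have "card (- T) = k" using that by (simp add: card_Compl_eq)
      then show "R \<in> H k" using T by (auto simp: H_def)
    qed
    show ?thesis using sub[OF that] sub[of "?n - k"] that by simp
  qed
  have "orbits (BijGroup (UNIV :: 'n set)) (ray ` (cut_vectors :: 'n weighted_dist set))
      (\<lambda>p R. relabel p ` R) =
      (\<lambda>S :: 'n set. F (card S)) ` (- {{}}) \<union> (\<lambda>S :: 'n set. H (card S)) ` (- {{}, UNIV})"
  proof -
    have "orbits (BijGroup (UNIV :: 'n set)) (ray ` (cut_vectors :: 'n weighted_dist set))
        (\<lambda>p R. relabel p ` R) =
      (\<lambda>x. orbit (BijGroup UNIV) (\<lambda>p R. relabel p ` R) (ray x)) ` cut_vectors"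
      unfolding orbits_def by blast
    then show ?thesis
      unfolding cut_vectors_def image_Un image_image orbit_ray_cut F_def H_def .
  qed
  also have "(\<lambda>S :: 'n set. F (card S)) ` (- {{}}) = F ` {1..?n}"
  proof (intro equalityI subsetI)
    fix X assume "X \<in> F ` {1..?n}"
    then obtain k where k: "X = F k" "1 \<le> k" "k \<le> ?n" by auto
    then obtain S :: "'n set" where "card S = k" using ex by blast
    then show "X \<in> (\<lambda>S :: 'n set. F (card S)) ` (- {{}})" using k nonempty by blast
  qed (auto simp: Suc_le_eq card_gt_0_iff card_mono)
  also have "(\<lambda>S :: 'n set. H (card S)) ` (- {{}, UNIV}) = H ` {1..?n div 2}"
  proof (intro equalityI subsetI)
    fix X assume "X \<in> H ` {1..?n div 2}"
    then obtain k where k: "X = H k" "1 \<le> k" "k \<le> ?n div 2" by auto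
    then obtain S :: "'n set" where S: "card S = k" using ex[of k] by fastforce
    then have "S \<noteq> {}" "S \<noteq> UNIV" using k nonempty[of S] nonfull[of S] by auto
    then show "X \<in> (\<lambda>S :: 'n set. H (card S)) ` (- {{}, UNIV})" using k S by blast
  next
    fix X assume "X \<in> (\<lambda>S :: 'n set. H (card S)) ` (- {{}, UNIV})"
    then obtain S :: "'n set" where S: "X = H (card S)" "S \<noteq> {}" "S \<noteq> UNIV" by blast
    then have c: "0 < card S" "card S < ?n"
      by (auto simp: card_gt_0_iff intro: psubset_card_mono)
    show "X \<in> H ` {1..?n div 2}"
    proof (cases "card S \<le> ?n div 2")
      case True
      then show ?thesis using S c by auto
    next
      case False
      then have "?n - card S \<in> {1..?n div 2}" using c by auto
      moreover have "X = H (?n - card S)" using Hsym[of "card S"] S c by simp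
      ultimately show ?thesis by blast
    qed
  qed
  finally have orbits: "orbits (BijGroup (UNIV :: 'n set)) (ray ` (cut_vectors :: 'n weighted_dist set))
      (\<lambda>p R. relabel p ` R) = F ` {1..?n} \<union> H ` {1..?n div 2}" .
  have F_mem: "\<exists>T. card T = k \<and> T \<noteq> {} \<and> ray (cut_dist T, indicator_vec T) \<in> F k" if "1 \<le> k" "k \<le> ?n" for k
    using ex[OF that(2)] nonempty that unfolding F_def by blast
  have "inj_on F {1..?n}"
  proof (rule inj_onI)
    fix k l assume kl: "k \<in> {1..?n}" "l \<in> {1..?n}" "F k = F l"
    obtain T where T: "card T = k" "T \<noteq> {}" "ray (cut_dist T, indicator_vec T) \<in> F l"
      using F_mem[of k] kl(1) by (auto simp: kl(3))
    then obtain U where U: "card U = l"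
        "ray (cut_dist T, indicator_vec T) = ray (cut_dist U, indicator_vec U)"
      unfolding F_def by blast
    have "U \<noteq> {}" using U(1) kl(2) by auto
    then have "(cut_dist T, indicator_vec T) = (cut_dist U, indicator_vec U :: real^'n)"
      using U(2) T(2) by (intro inj) (auto simp: cut_vectors_def)
    then show "k = l" using T(1) U(1) by (simp add: indicator_vec_eq_iff)
  qed
  moreover have "inj_on H {1..?n div 2}"
  proof (rule inj_onI)
    fix k l assume kl: "k \<in> {1..?n div 2}" "l \<in> {1..?n div 2}" "H k = H l"
    obtain T :: "'n set" where T: "card T = k" using ex[of k] kl(1) by fastforce
    then have "ray (cut_dist T, 0) \<in> H k" unfolding H_def by blast
    then have "ray (cut_dist T, 0) \<in> H l" by (simp only: kl(3))
    then obtain U where U: "card U = l" "ray (cut_dist T, 0) = ray (cut_dist U, 0 :: real^'n)"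
      unfolding H_def by blast
    have "T \<noteq> {}" "T \<noteq> UNIV" "U \<noteq> {}" "U \<noteq> UNIV"
      using T U(1) kl nonempty[of T] nonempty[of U] nonfull[of T] nonfull[of U] by auto
    then have "(cut_dist T, 0) = (cut_dist U, 0 :: real^'n)"
      using U(2) by (intro inj) (auto simp: cut_vectors_def)
    then have "U = T \<or> U = - T" by (simp add: cut_dist_eq_iff)
    then have "l = k \<or> l = ?n - k" using T U(1) by (auto simp: card_Compl_eq)
    \<comment> \<open>If the sizes add up to n while neither exceeds n div 2, both are half of
      n.\<close>
    then show "k = l" using kl by auto
  qed
  moreover have "F ` {1..?n} \<inter> H ` {1..?n div 2} = {}"
  proof -
    have "F k \<noteq> H l" if kl: "k \<in> {1..?n}" "l \<in> {1..?n div 2}" for k l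
    proof
      assume eq: "F k = H l"
      obtain T where T: "card T = k" "T \<noteq> {}" "ray (cut_dist T, indicator_vec T) \<in> H l"
        using F_mem[of k] kl(1) by (auto simp: eq)
      then obtain U where U: "card U = l"
          "ray (cut_dist T, indicator_vec T) = ray (cut_dist U, 0 :: real^'n)"
        unfolding H_def by blast
      have "U \<noteq> {}" "U \<noteq> UNIV" using U(1) kl(2) nonempty[of U] nonfull[of U] by auto
      then have "(cut_dist T, indicator_vec T) = (cut_dist U, 0 :: real^'n)"
        using U(2) T(2) by (intro inj) (auto simp: cut_vectors_def)
      then show False using T(2) by (simp add: indicator_vec_eq_zero_iff)
    qed
    then show ?thesis by blast
  qed
  ultimately have "card (F ` {1..?n} \<union> H ` {1..?n div 2}) = ?n + ?n div 2"
    by (simp add: card_Un_disjoint card_image)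
  also have "\<dots> = 3 * ?n div 2" by presburger
  finally show ?thesis unfolding orbits .
qed

theorem theorem3:
  shows
    "{x \<in> (dWMET :: ('n::finite) weighted_dist set). zero_one_valued x} =
       {(multicut P, w) | P w. partition_on UNIV P \<and> (\<forall>i. w $ i \<in> {0, 1}) \<and>
                               (\<forall>A\<in>P. \<forall>i\<in>A. \<forall>j\<in>A. w $ i = w $ j)} \<and>
     card {x \<in> (dWMET :: 'n weighted_dist set). zero_one_valued x} =
       (\<Sum>t = 1..CARD('n). 2 ^ t * Stirling CARD('n) t) \<and>
     extreme_rays (zero_one_dWMET :: 'n weighted_dist set) =
       insert (cone hull {(0, indicator_vec UNIV)})
         (\<Union>S \<in> {S. S \<noteq> {} \<and> S \<subset> UNIV}.
            {cone hull {(cut_dist S, 0)},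
             cone hull {(cut_dist S, indicator_vec S)},
             cone hull {(cut_dist S, indicator_vec (- S))}}) \<and>
     card (extreme_rays (zero_one_dWMET :: 'n weighted_dist set)) =
       1 + 3 * (2 ^ (CARD('n) - 1) - 1) \<and>
     card (orbits (BijGroup (UNIV :: 'n set))
                  (extreme_rays (zero_one_dWMET :: 'n weighted_dist set))
                  (\<lambda>p R. relabel p ` R)) = 3 * CARD('n) div 2"
proof (intro conjI)
  show "extreme_rays (zero_one_dWMET :: 'n weighted_dist set) =
       insert (cone hull {(0, indicator_vec UNIV)})
         (\<Union>S \<in> {S. S \<noteq> {} \<and> S \<subset> UNIV}.
            {cone hull {(cut_dist S, 0)},
             cone hull {(cut_dist S, indicator_vec S)},
             cone hull {(cut_dist S, indicator_vec (- S))}})"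
    unfolding extreme_rays_zero_one_dWMET by (rule ray_image_cut_vectors)
  show "card (extreme_rays (zero_one_dWMET :: 'n weighted_dist set)) =
       1 + 3 * (2 ^ (CARD('n) - 1) - 1)"
    unfolding extreme_rays_zero_one_dWMET
    by (simp add: card_image[OF inj_on_ray_cut_vectors] card_cut_vectors)
  show "card (orbits (BijGroup (UNIV :: 'n set))
                  (extreme_rays (zero_one_dWMET :: 'n weighted_dist set))
                  (\<lambda>p R. relabel p ` R)) = 3 * CARD('n) div 2"
    unfolding extreme_rays_zero_one_dWMET by (rule card_orbits_ray_cut_vectors)
qed (fact zero_one_dWMET_eq card_zero_one_dWMET)+

end
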